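(* Let $\mathbb{M}=\langle V,D,\cdot_{\mathbb{M}}\rangle$ be a $\Sigma$-PNmatrix and let $\mathsf{Ax}\subseteq L_\Sigma(P)$. Define the $\Sigma$-PNmatrix $\mathbb{M}^\flat_{\mathsf{Ax}}=\langle V^\flat_{\mathsf{Ax}},D^\flat_{\mathsf{Ax}},\cdot_{\mathbb{M}^\flat_{\mathsf{Ax}}}\rangle$ by \begin{itemize} \item $V^\flat_{\mathsf{Ax}}=\{(x,A)\in V\times L_\Sigma(P):\text{ if }A\in\mathsf{Ax}^{\mathsf{inst}}\text{ then }x\in D\}$, \item $D^\flat_{\mathsf{Ax}}=D\times L_\Sigma(P)$, \item for each $k\in\mathbb{N}$ and each $k$-place connective $c\in\Sigma^{(k)}$, $$c_{\mathbb{M}^\flat_{\mathsf{Ax}}}((x_1,A_1),\ldots,(x_k,A_k))=\{(x,c(A_1,\dots,A_k))\in V^\flat_{\mathsf{Ax}}:x\in c_{\mathbb{M}}(x_1,\dots,x_k)\}.$$ \end{itemize} Then $\mathbb{M}^\flat_{\mathsf{Ax}}$ is a rexpansion of $\mathbb{M}$, and the consequence relation $\vdash_{\mathbb{M}}^{\mathsf{Ax}}$ is characterized by $\mathbb{M}^\flat_{\mathsf{Ax}}$, that is, $\vdash_{\mathbb{M}}^{\mathsf{Ax}}\;=\;\vdash_{\mathbb{M}^\flat_{\mathsf{Ax}}}$.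
   Context: A signature $\Sigma$ is a family $\{\Sigma^{(k)}\}_{k\in\mathbb{N}}$ of sets, $\Sigma^{(k)}$ being the set of $k$-place connectives. $L_\Sigma(P)$ is the set of formulas (the absolutely free $\Sigma$-algebra) over a fixed denumerable set $P$ of sentential variables. A substitution is a function $\sigma:P\to L_\Sigma(P)$; $A^\sigma$ is the result of applying (the endomorphism extending) $\sigma$ to $A$. For $\Gamma\subseteq L_\Sigma(P)$, $\Gamma^{\mathsf{inst}}=\{A^\sigma: A\in\Gamma,\ \sigma:P\to L_\Sigma(P)\}$. A $\Sigma$-PNmatrix (partial non-deterministic matrix) is $\mathbb{M}=\langle V,D,\cdot_{\mathbb{M}}\rangle$ with $V$ a set (truth-values), $D\subseteq V$ (designated values), and, for each $k$ and each $c\in\Sigma^{(k)}$, a function $c_{\mathbb{M}}:V^k\to\wp(V)$ (the empty set is an allowed output). An $\mathbb{M}$-valuation is a function $v:L_\Sigma(P)\to V$ with $v(c(A_1,\dots,A_k))\in c_{\mathbb{M}}(v(A_1),\dots,v(A_k))$ for all $k$, all $c\in\Sigma^{(k)}$ and all formulas $A_1,\dots,A_k$; $\mathrm{Val}_{\mathbb{M}}$ is the set of all $\mathbb{M}$-valuations. The consequence relation characterized by $\mathbb{M}$ is: $\Gamma\vdash_{\mathbb{M}}A$ iff for every $v\in\mathrm{Val}_{\mathbb{M}}$, $v(\Gamma)\subseteq D$ implies $v(A)\in D$. The strengthening of $\vdash_{\mathbb{M}}$ with (schema) axioms $\mathsf{Ax}$ is the relation: $\Gamma\vdash_{\mathbb{M}}^{\mathsf{Ax}}A$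 iff $\Gamma\cup\mathsf{Ax}^{\mathsf{inst}}\vdash_{\mathbb{M}}A$. Rexpansions: a refinement of $\mathbb{M}=\langle V,D,\cdot_{\mathbb{M}}\rangle$ is any $\Sigma$-PNmatrix $\mathbb{M}'=\langle V',D',\cdot_{\mathbb{M}'}\rangle$ with $V'\subseteq V$, $D'=D\cap V'$ and $c_{\mathbb{M}'}(x_1,\dots,x_k)\subseteq c_{\mathbb{M}}(x_1,\dots,x_k)$ for all $c\in\Sigma^{(k)}$ and $x_1,\dots,x_k\in V'$. An expansion function is $\mathcal{E}:V\to\wp(U)$ (for some set $U$) with $\mathcal{E}(x)\neq\emptyset$ for all $x\in V$ and $\mathcal{E}(x)\cap\mathcal{E}(x')=\emptyset$ for $x\neq x'$; put $\mathcal{E}(X)=\bigcup_{x\in X}\mathcal{E}(x)$ for $X\subseteq V$, and let $\widetilde{\mathcal{E}}:\mathcal{E}(V)\to V$ send $y$ to the unique $x$ with $y\in\mathcal{E}(x)$. The $\mathcal{E}$-expansion of $\mathbb{M}$ is $\mathcal{E}(\mathbb{M})=\langle\mathcal{E}(V),\mathcal{E}(D),\cdot_{\mathcal{E}(\mathbb{M})}\rangle$ with $c_{\mathcal{E}(\mathbb{M})}(y_1,\dots,y_k)=\mathcal{E}(c_{\mathbb{M}}(\widetilde{\mathcal{E}}(y_1),\dots,\widetilde{\mathcal{E}}(y_k)))$. A rexpansion of $\mathbb{M}$ is a refinement of some $\mathcal{E}$-expansion of $\mathbb{M}$. *)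

theory Defs
  imports Main "HOL-Library.FuncSet" "HOL-Library.Countable_Set"
begin

text \<open>
  A signature is a family \<open>\<Sigma> :: nat \<Rightarrow> 'c set\<close>, where \<open>\<Sigma> k\<close> is the set of \<open>k\<close>-place connectives.
  These sets need not be disjoint: an occurrence of a connective is identified by its name
  together with the length of its argument list.  The datatype contains raw terms; the formulas
  over \<open>\<Sigma>\<close> and the set \<open>P\<close> of variables are the elements of \<open>formulas \<Sigma> P\<close>.
\<close>

type_synonym 'c signature = "nat \<Rightarrow> 'c set"

datatype ('c, 'p) fm = Var 'p | App 'c "('c, 'p) fm list"

inductive_set formulas :: "'c signature \<Rightarrow> 'p set \<Rightarrow> ('c, 'p) fm set"
  for \<Sigma> :: "'c signature" and P :: "'p set"
where
  Var: "p \<in> P \<Longrightarrow> Var p \<in> formulas \<Sigma> P"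
| App: "c \<in> \<Sigma> (length As) \<Longrightarrow> \<forall>A\<in>set As. A \<in> formulas \<Sigma> P \<Longrightarrow> App c As \<in> formulas \<Sigma> P"

primrec subst :: "('p \<Rightarrow> ('c, 'p) fm) \<Rightarrow> ('c, 'p) fm \<Rightarrow> ('c, 'p) fm" where
  "subst \<sigma> (Var p) = \<sigma> p"
| "subst \<sigma> (App c As) = App c (map (subst \<sigma>) As)"

definition inst :: "'c signature \<Rightarrow> 'p set \<Rightarrow> ('c, 'p) fm set \<Rightarrow> ('c, 'p) fm set" where
  "inst \<Sigma> P \<Gamma> = {subst \<sigma> A | \<sigma> A. A \<in> \<Gamma> \<and> \<sigma> \<in> P \<rightarrow> formulas \<Sigma> P}"

text \<open>
  \<open>interp M c xs\<close> is the set of possible values of the \<open>length xs\<close>-place connective \<open>c\<close> at the tuple \<open>xs\<close>.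
  It is only meaningful for \<open>c \<in> \<Sigma> (length xs)\<close> and \<open>set xs \<subseteq> vals M\<close>, and all notions below
  only inspect it there.
\<close>

record ('c, 'v) pnmatrix =
  vals :: "'v set"
  desig :: "'v set"
  interp :: "'c \<Rightarrow> 'v list \<Rightarrow> 'v set"

definition is_pnmatrix :: "'c signature \<Rightarrow> ('c, 'v) pnmatrix \<Rightarrow> bool" where
  "is_pnmatrix \<Sigma> M \<longleftrightarrow>
     desig M \<subseteq> vals M \<and>
     (\<forall>k. \<forall>c\<in>\<Sigma> k. \<forall>xs. length xs = k \<and> set xs \<subseteq> vals M \<longrightarrow> interp M c xs \<subseteq> vals M)"

text \<open>Valuations are total HOL functions; their values outside \<open>formulas \<Sigma> P\<close> are irrelevant.\<close>

definition Val :: "'c signature \<Rightarrow> 'p set \<Rightarrow> ('c, 'v) pnmatrix \<Rightarrow> (('c, 'p) fm \<Rightarrow> 'v) set" where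
  "Val \<Sigma> P M =
     {v \<in> formulas \<Sigma> P \<rightarrow> vals M.
        \<forall>k. \<forall>c\<in>\<Sigma> k. \<forall>As. length As = k \<and> set As \<subseteq> formulas \<Sigma> P \<longrightarrow>
          v (App c As) \<in> interp M c (map v As)}"

definition conseq :: "'c signature \<Rightarrow> 'p set \<Rightarrow> ('c, 'v) pnmatrix \<Rightarrow>
    (('c, 'p) fm set \<times> ('c, 'p) fm) set" where
  "conseq \<Sigma> P M =
     {(\<Gamma>, A). \<Gamma> \<subseteq> formulas \<Sigma> P \<and> A \<in> formulas \<Sigma> P \<and>
        (\<forall>v\<in>Val \<Sigma> P M. v ` \<Gamma> \<subseteq> desig M \<longrightarrow> v A \<in> desig M)}"

definition conseq_ax :: "'c signature \<Rightarrow> 'p set \<Rightarrow> ('c, 'v) pnmatrix \<Rightarrow> ('c, 'p) fm set \<Rightarrow>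
    (('c, 'p) fm set \<times> ('c, 'p) fm) set" where
  "conseq_ax \<Sigma> P M Ax =
     {(\<Gamma>, A). \<Gamma> \<subseteq> formulas \<Sigma> P \<and> A \<in> formulas \<Sigma> P \<and> (\<Gamma> \<union> inst \<Sigma> P Ax, A) \<in> conseq \<Sigma> P M}"

definition refinement :: "'c signature \<Rightarrow> ('c, 'v) pnmatrix \<Rightarrow> ('c, 'v) pnmatrix \<Rightarrow> bool" where
  "refinement \<Sigma> M M' \<longleftrightarrow>
     is_pnmatrix \<Sigma> M' \<and>
     vals M' \<subseteq> vals M \<and>
     desig M' = desig M \<inter> vals M' \<and>
     (\<forall>k. \<forall>c\<in>\<Sigma> k. \<forall>xs. length xs = k \<and> set xs \<subseteq> vals M' \<longrightarrow> interp M' c xs \<subseteq> interp M c xs)"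

text \<open>The codomain \<open>U\<close> of an expansion function is the universe of the type \<open>'u\<close>.\<close>

definition expansion_function :: "'v set \<Rightarrow> ('v \<Rightarrow> 'u set) \<Rightarrow> bool" where
  "expansion_function V E \<longleftrightarrow>
     (\<forall>x\<in>V. E x \<noteq> {}) \<and> (\<forall>x\<in>V. \<forall>x'\<in>V. x \<noteq> x' \<longrightarrow> E x \<inter> E x' = {})"

definition unexpand :: "'v set \<Rightarrow> ('v \<Rightarrow> 'u set) \<Rightarrow> 'u \<Rightarrow> 'v" where
  "unexpand V E y = (THE x. x \<in> V \<and> y \<in> E x)"

definition expansion :: "('v \<Rightarrow> 'u set) \<Rightarrow> ('c, 'v) pnmatrix \<Rightarrow> ('c, 'u) pnmatrix" where
  "expansion E M =
     \<lparr>vals = (\<Union>x\<in>vals M. E x),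
      desig = (\<Union>x\<in>desig M. E x),
      interp = (\<lambda>c ys. \<Union>x\<in>interp M c (map (unexpand (vals M) E) ys). E x)\<rparr>"

definition rexpansion :: "'c signature \<Rightarrow> ('c, 'v) pnmatrix \<Rightarrow> ('c, 'u) pnmatrix \<Rightarrow> bool" where
  "rexpansion \<Sigma> M M' \<longleftrightarrow>
     (\<exists>E. expansion_function (vals M) E \<and> refinement \<Sigma> (expansion E M) M')"

definition flat_vals :: "'c signature \<Rightarrow> 'p set \<Rightarrow> ('c, 'v) pnmatrix \<Rightarrow> ('c, 'p) fm set \<Rightarrow>
    ('v \<times> ('c, 'p) fm) set" where
  "flat_vals \<Sigma> P M Ax =
     {(x, A) \<in> vals M \<times> formulas \<Sigma> P. A \<in> inst \<Sigma> P Ax \<longrightarrow> x \<in> desig M}"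

definition flat :: "'c signature \<Rightarrow> 'p set \<Rightarrow> ('c, 'v) pnmatrix \<Rightarrow> ('c, 'p) fm set \<Rightarrow>
    ('c, 'v \<times> ('c, 'p) fm) pnmatrix" where
  "flat \<Sigma> P M Ax =
     \<lparr>vals = flat_vals \<Sigma> P M Ax,
      desig = desig M \<times> formulas \<Sigma> P,
      interp = (\<lambda>c ys. {(x, App c (map snd ys)) | x.
                  (x, App c (map snd ys)) \<in> flat_vals \<Sigma> P M Ax \<and>
                  x \<in> interp M c (map fst ys)})\<rparr>"

end

theory Submission
  imports Defs
begin

text \<open>
  The second components of a \<open>flat\<close>-valuation form a substitution \<open>\<sigma>\<close> applied to the formula
  (not necessarily the identity substitution), and instances of axioms are closed under
  substitution, so the first components form an \<open>M\<close>-valuation designating every axiom instance.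
  Conversely, an \<open>M\<close>-valuation \<open>v\<close> designating all axiom instances lifts to \<open>A \<mapsto> (v A, A)\<close>.
\<close>

lemma subst_in_formulas:
  assumes "A \<in> formulas \<Sigma> P" and "\<sigma> \<in> P \<rightarrow> formulas \<Sigma> P"
  shows "subst \<sigma> A \<in> formulas \<Sigma> P"
  using assms(1)
proof induction
  case (Var p)
  then show ?case using assms(2) by auto
next
  case (App c As)
  then show ?case by (auto intro!: formulas.App)
qed

lemma subst_subst: "subst \<sigma> (subst \<tau> A) = subst (subst \<sigma> \<circ> \<tau>) A"
  by (induction A) auto

lemma inst_subset_formulas:
  assumes "\<Gamma> \<subseteq> formulas \<Sigma> P"
  shows "inst \<Sigma> P \<Gamma> \<subseteq> formulas \<Sigma> P"
  using assms subst_in_formulas unfolding inst_def by blast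

text \<open>Instantiating by \<tau> and then by \<sigma> is a single instantiation by the composite
  \<open>subst \<sigma> \<circ> \<tau>\<close>, which again sends variables to formulas.\<close>

lemma subst_in_inst:
  assumes "A \<in> inst \<Sigma> P \<Gamma>" and "\<sigma> \<in> P \<rightarrow> formulas \<Sigma> P"
  shows "subst \<sigma> A \<in> inst \<Sigma> P \<Gamma>"
proof -
  obtain \<tau> B where B: "A = subst \<tau> B" "B \<in> \<Gamma>" "\<tau> \<in> P \<rightarrow> formulas \<Sigma> P"
    using assms(1) unfolding inst_def by blast
  have "subst \<sigma> \<circ> \<tau> \<in> P \<rightarrow> formulas \<Sigma> P"
    using B(3) assms(2) by (auto intro!: subst_in_formulas)
  then show ?thesis
    using B(1,2) unfolding inst_def by (auto simp: subst_subst)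
qed

lemma unexpand_eq:
  assumes "expansion_function V E" and "x \<in> V" and "y \<in> E x"
  shows "unexpand V E y = x"
  unfolding unexpand_def
proof (rule the_equality)
  show "x \<in> V \<and> y \<in> E x"
    using assms by simp
  show "x' = x" if "x' \<in> V \<and> y \<in> E x'" for x'
    using assms that unfolding expansion_function_def by blast
qed

lemma rexpansion_flat:
  fixes Ax :: "('c, 'p) fm set"
  assumes "is_pnmatrix \<Sigma> M"
  shows "rexpansion \<Sigma> M (flat \<Sigma> P M Ax)"
proof -
  \<comment> \<open>Each value splits into copies labelled by all raw terms; \<open>UNIV\<close>
    keeps every \<open>?E x\<close> nonempty whatever \<open>P\<close> is. The refinement then
    discards labels that are not formulas and undesignated copies labelled by axiom
    instances.\<close>
  let ?E = "\<lambda>x. {x} \<times> (UNIV :: ('c, 'p) fm set)"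
  have D: "desig M \<subseteq> vals M"
    using assms by (simp add: is_pnmatrix_def)
  have E: "expansion_function (vals M) ?E"
    by (auto simp: expansion_function_def)
  \<comment> \<open>The definite description in \<open>unexpand\<close> is determined only on
    expanded values, whence the restriction on \<open>ys\<close>.\<close>
  have un: "map (unexpand (vals M) ?E) ys = map fst ys"
    if "set ys \<subseteq> flat_vals \<Sigma> P M Ax" for ys
  proof (rule map_cong[OF refl])
    fix y
    assume "y \<in> set ys"
    then have "fst y \<in> vals M"
      using that by (auto simp: flat_vals_def)
    then show "unexpand (vals M) ?E y = fst y"
      by (rule unexpand_eq[OF E]) (simp add: mem_Times_iff)
  qed
  have "is_pnmatrix \<Sigma> (flat \<Sigma> P M Ax)"
    using D by (auto simp: is_pnmatrix_def flat_def flat_vals_def)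
  moreover have "desig (flat \<Sigma> P M Ax) = desig (expansion ?E M) \<inter> vals (flat \<Sigma> P M Ax)"
    using D by (auto simp: flat_def expansion_def flat_vals_def)
  moreover have "vals (flat \<Sigma> P M Ax) \<subseteq> vals (expansion ?E M)"
    by (auto simp: flat_def expansion_def flat_vals_def)
  moreover have "interp (flat \<Sigma> P M Ax) c ys \<subseteq> interp (expansion ?E M) c ys"
    if "set ys \<subseteq> vals (flat \<Sigma> P M Ax)" for c ys
    using that by (auto simp: flat_def expansion_def un simp del: map_eq_conv)
  ultimately have "refinement \<Sigma> (expansion ?E M) (flat \<Sigma> P M Ax)"
    by (simp add: refinement_def)
  with E show ?thesis
    unfolding rexpansion_def by blast
qed

text \<open>An output of \<open>flat\<close> at \<open>ys\<close> always carries the label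
  \<open>App c (map snd ys)\<close>, so labels commute with the connectives and are fixed by those
  of the variables.\<close>

lemma snd_flat_valuation:
  assumes "v \<in> Val \<Sigma> P (flat \<Sigma> P M Ax)" and "A \<in> formulas \<Sigma> P"
  shows "snd (v A) = subst (\<lambda>p. snd (v (Var p))) A"
  using assms(2)
proof induction
  case (Var p)
  then show ?case by simp
next
  case (App c As)
  have "v (App c As) \<in> interp (flat \<Sigma> P M Ax) c (map v As)"
    using assms(1) App by (auto simp: Val_def subset_iff)
  then show ?case
    using App by (auto simp: flat_def)
qed

text \<open>On first components \<open>flat\<close> only removes options from
  \<open>interp M\<close>, so projecting keeps every constraint of \<open>M\<close>.\<close>

lemma fst_flat_valuation:
  assumes "v \<in> Val \<Sigma> P (flat \<Sigma> P M Ax)"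
  shows "fst \<circ> v \<in> Val \<Sigma> P M"
proof -
  have "fst (v A) \<in> vals M" if "A \<in> formulas \<Sigma> P" for A
  proof -
    have "v A \<in> flat_vals \<Sigma> P M Ax"
      using assms that by (auto simp: Val_def flat_def)
    then show ?thesis by (auto simp: flat_vals_def)
  qed
  moreover have "fst (v (App c As)) \<in> interp M c (map (fst \<circ> v) As)"
    if "c \<in> \<Sigma> (length As)" "set As \<subseteq> formulas \<Sigma> P" for c As
  proof -
    have "v (App c As) \<in> interp (flat \<Sigma> P M Ax) c (map v As)"
      using assms that by (auto simp: Val_def)
    then show ?thesis by (auto simp: flat_def)
  qed
  ultimately show ?thesis by (auto simp: Val_def)
qed

lemma flat_valuation_in_flat_vals:
  assumes "v \<in> Val \<Sigma> P (flat \<Sigma> P M Ax)" and "A \<in> formulas \<Sigma> P"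
  shows "v A \<in> flat_vals \<Sigma> P M Ax"
  using assms by (auto simp: Val_def flat_def)

lemma flat_valuation_designated_iff:
  assumes "v \<in> Val \<Sigma> P (flat \<Sigma> P M Ax)" and "A \<in> formulas \<Sigma> P"
  shows "v A \<in> desig (flat \<Sigma> P M Ax) \<longleftrightarrow> fst (v A) \<in> desig M"
  using flat_valuation_in_flat_vals[OF assms]
  by (auto simp: flat_def flat_vals_def mem_Times_iff)

text \<open>The constraint in \<open>flat_vals\<close> looks at the label \<open>snd (v A)\<close>,
  which may differ from \<open>A\<close>. It still applies, because the label is a substitution
  instance of \<open>A\<close> and hence an axiom instance too.\<close>

lemma flat_valuation_designates_axioms:
  assumes v: "v \<in> Val \<Sigma> P (flat \<Sigma> P M Ax)" and "Ax \<subseteq> formulas \<Sigma> P"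
    and A: "A \<in> inst \<Sigma> P Ax"
  shows "fst (v A) \<in> desig M"
proof -
  have "(\<lambda>p. snd (v (Var p))) \<in> P \<rightarrow> formulas \<Sigma> P"
    using flat_valuation_in_flat_vals[OF v formulas.Var] by (force simp: flat_vals_def)
  moreover have AF: "A \<in> formulas \<Sigma> P"
    using inst_subset_formulas assms(2) A by blast
  ultimately have "snd (v A) \<in> inst \<Sigma> P Ax"
    using subst_in_inst[OF A] snd_flat_valuation[OF v AF] by simp
  then show ?thesis
    using flat_valuation_in_flat_vals[OF v AF] by (auto simp: flat_vals_def)
qed

text \<open>With each formula as its own label, the second assumption is exactly what places the
  pairs in \<open>flat_vals\<close>.\<close>

lemma valuation_lifts_to_flat:
  assumes v: "v \<in> Val \<Sigma> P M" and "v ` inst \<Sigma> P Ax \<subseteq> desig M"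
  shows "(\<lambda>A. (v A, A)) \<in> Val \<Sigma> P (flat \<Sigma> P M Ax)"
proof -
  have mem: "(v A, A) \<in> vals (flat \<Sigma> P M Ax)" if "A \<in> formulas \<Sigma> P" for A
    using assms that by (auto simp: Val_def flat_def flat_vals_def)
  moreover have "(v (App c As), App c As)
      \<in> interp (flat \<Sigma> P M Ax) c (map (\<lambda>A. (v A, A)) As)"
    if "c \<in> \<Sigma> (length As)" "set As \<subseteq> formulas \<Sigma> P" for c As
  proof -
    have "App c As \<in> formulas \<Sigma> P"
      using that by (auto intro: formulas.App)
    moreover have "v (App c As) \<in> interp M c (map v As)"
      using v that by (auto simp: Val_def)
    ultimately show ?thesis
      using mem by (auto simp: flat_def comp_def)
  qed
  ultimately show ?thesis by (auto simp: Val_def)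
qed

lemma conseq_ax_eq_conseq_flat:
  assumes "Ax \<subseteq> formulas \<Sigma> P"
  shows "conseq_ax \<Sigma> P M Ax = conseq \<Sigma> P (flat \<Sigma> P M Ax)"
proof -
  have "(\<forall>v\<in>Val \<Sigma> P M. v ` (\<Gamma> \<union> inst \<Sigma> P Ax) \<subseteq> desig M \<longrightarrow> v A \<in> desig M) \<longleftrightarrow>
      (\<forall>v\<in>Val \<Sigma> P (flat \<Sigma> P M Ax). v ` \<Gamma> \<subseteq> desig (flat \<Sigma> P M Ax) \<longrightarrow>
        v A \<in> desig (flat \<Sigma> P M Ax))" (is "?L \<longleftrightarrow> ?R")
    if \<Gamma>: "\<Gamma> \<subseteq> formulas \<Sigma> P" and A: "A \<in> formulas \<Sigma> P" for \<Gamma> A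
  proof
    assume L: ?L
    show ?R
    proof (intro ballI impI)
      fix v
      assume v: "v \<in> Val \<Sigma> P (flat \<Sigma> P M Ax)" and "v ` \<Gamma> \<subseteq> desig (flat \<Sigma> P M Ax)"
      then have "fst (v B) \<in> desig M" if "B \<in> \<Gamma>" for B
        using that \<Gamma> flat_valuation_designated_iff[OF v] by blast
      then have "(fst \<circ> v) ` (\<Gamma> \<union> inst \<Sigma> P Ax) \<subseteq> desig M"
        using flat_valuation_designates_axioms[OF v assms] by auto
      then have "fst (v A) \<in> desig M"
        using L fst_flat_valuation[OF v] by fastforce
      then show "v A \<in> desig (flat \<Sigma> P M Ax)"
        using flat_valuation_designated_iff[OF v A] by simp
    qed
  next
    assume R: ?R
    show ?L
    proof (intro ballI impI)
      fix v
      assume v: "v \<in> Val \<Sigma> P M" and des: "v ` (\<Gamma> \<union> inst \<Sigma> P Ax) \<subseteq> desig M"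
      \<comment> \<open>The axiom part of \<open>des\<close> yields the lifted valuation; the
        \<Gamma> part then makes it designate the premises.\<close>
      have lift: "(\<lambda>B. (v B, B)) \<in> Val \<Sigma> P (flat \<Sigma> P M Ax)"
        using valuation_lifts_to_flat[OF v] des by blast
      have "(\<lambda>B. (v B, B)) ` \<Gamma> \<subseteq> desig (flat \<Sigma> P M Ax)"
        using des \<Gamma> by (auto simp: flat_def)
      then have "(v A, A) \<in> desig (flat \<Sigma> P M Ax)"
        using bspec[OF R lift] by simp
      then show "v A \<in> desig M"
        by (simp add: flat_def)
    qed
  qed
  then show ?thesis
    \<comment> \<open>This fact reduces well-formedness of
      \<open>\<Gamma> \<union> inst \<Sigma> P Ax\<close> to that of \<Gamma>, and
      \<open>conj_cong\<close> lets the equivalence be used under the side conditions on \<Gamma>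
      and \<open>A\<close>.\<close>
    using inst_subset_formulas[OF assms]
    by (auto simp: conseq_ax_def conseq_def cong: conj_cong)
qed

theorem theorem3p2:
  fixes \<Sigma> :: "'c signature" and P :: "'p set"
    and M :: "('c, 'v) pnmatrix" and Ax :: "('c, 'p) fm set"
  assumes "countable P" and "infinite P"
    and "is_pnmatrix \<Sigma> M"
    and "Ax \<subseteq> formulas \<Sigma> P"
  shows "rexpansion \<Sigma> M (flat \<Sigma> P M Ax) \<and>
         conseq_ax \<Sigma> P M Ax = conseq \<Sigma> P (flat \<Sigma> P M Ax)"
  using rexpansion_flat[OF assms(3)] conseq_ax_eq_conseq_flat[OF assms(4)] by blast

end
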